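(* For every integer $n\ge 1$: a $(2^{2n}-1,n,>1/2)$-QRAC exists, but a $(2^{2n},n,>1/2)$-QRAC does not exist. Moreover, a $(2^n-1,n,>1/2)$-RAC exists, but a $(2^n,n,>1/2)$-RAC does not exist.
   Context: An $(m,n,p)$-QRAC (quantum random access coding) is an encoding of $m$ bits into $n$ qubits such that any one of the $m$ bits can be recovered with probability at least $p$: for each $x\in\{0,1\}^m$ there is an $n$-qubit state $\rho_x$ (a $2^n\times 2^n$ positive semidefinite complex matrix of trace $1$), and for each $i\in\{1,\dots,m\}$ a two-outcome POVM $\{E_i,I-E_i\}$ ($E_i$ and $I-E_i$ positive semidefinite, outcome $0$ corresponding to $E_i$), such that for all $x$ and $i$ measuring $\rho_x$ with the $i$-th POVM gives outcome $x_i$ with probability at least $p$ (outcome $0$ has probability $\mathrm{Tr}(E_i\rho_x)$). An $(m,n,p)$-RAC (classical random access coding) is the classical analogue: for each $x\in\{0,1\}^m$ a probability distribution $q_x$ on $\{0,1\}^n$, and for each $i\in\{1,\dots,m\}$ and $s\in\{0,1\}^n$ a probability $l_i(s)\in[0,1]$ of outputting $0$ on codeword $s$, such that for all $x,i$ the output equals $x_i$ with probability at least $p$ (output $0$ has probability $\sum_s q_x(s)l_i(s)$). No randomness is shared between encoder and decoder. "$>1/2$" in place of $p$ means that the success probability is strictly greater than $1/2$ for every $x$ and every $i$. *)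

theory Defs
  imports
    "Jordan_Normal_Form.Schur_Decomposition"
    "HOL-Probability.Probability_Mass_Function"
begin

(* Bits are booleans (True is 1, False is 0); bit positions are counted from 0. *)
definition bitstrings :: "nat \<Rightarrow> bool list set" where
  "bitstrings m = {x. length x = m}"

definition mat_trace :: "complex mat \<Rightarrow> complex" where
  "mat_trace A = (\<Sum>i<dim_row A. A $$ (i, i))"

definition pos_semidef :: "nat \<Rightarrow> complex mat \<Rightarrow> bool" where
  "pos_semidef d A \<longleftrightarrow>
     A \<in> carrier_mat d d \<and> mat_adjoint A = A \<and>
     (\<forall>v \<in> carrier_vec d. Re ((A *\<^sub>v v) \<bullet>c v) \<ge> 0)"

definition qubit_state :: "nat \<Rightarrow> complex mat \<Rightarrow> bool" where
  "qubit_state n \<rho> \<longleftrightarrow> pos_semidef (2 ^ n) \<rho> \<and> mat_trace \<rho> = 1"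

(* The POVM {E, I - E} on n qubits, given by its element E for outcome 0. *)
definition qubit_povm :: "nat \<Rightarrow> complex mat \<Rightarrow> bool" where
  "qubit_povm n E \<longleftrightarrow> pos_semidef (2 ^ n) E \<and> pos_semidef (2 ^ n) (1\<^sub>m (2 ^ n) - E)"

(* Born rule; the trace is real for a state and a POVM element, so Re loses nothing. *)
definition povm_prob :: "nat \<Rightarrow> complex mat \<Rightarrow> complex mat \<Rightarrow> bool \<Rightarrow> real" where
  "povm_prob n E \<rho> b =
     Re (mat_trace ((if b then 1\<^sub>m (2 ^ n) - E else E) * \<rho>))"

(* An (m, n, > p)-QRAC exists. *)
definition QRAC_gt :: "nat \<Rightarrow> nat \<Rightarrow> real \<Rightarrow> bool" where
  "QRAC_gt m n p \<longleftrightarrow>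
     (\<exists>(\<rho> :: bool list \<Rightarrow> complex mat) (E :: nat \<Rightarrow> complex mat).
        (\<forall>x \<in> bitstrings m. qubit_state n (\<rho> x)) \<and>
        (\<forall>i < m. qubit_povm n (E i)) \<and>
        (\<forall>x \<in> bitstrings m. \<forall>i < m. povm_prob n (E i) (\<rho> x) (x ! i) > p))"

(* Probability of output b when the codeword has distribution q and the decoder
   outputs 0 on codeword s with probability l s. *)
definition decode_prob :: "nat \<Rightarrow> (bool list \<Rightarrow> real) \<Rightarrow> bool list pmf \<Rightarrow> bool \<Rightarrow> real" where
  "decode_prob n l q b =
     (\<Sum>s \<in> bitstrings n. pmf q s * (if b then 1 - l s else l s))"

(* An (m, n, > p)-RAC exists. *)
definition RAC_gt :: "nat \<Rightarrow> nat \<Rightarrow> real \<Rightarrow> bool" where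
  "RAC_gt m n p \<longleftrightarrow>
     (\<exists>(q :: bool list \<Rightarrow> bool list pmf) (l :: nat \<Rightarrow> bool list \<Rightarrow> real).
        (\<forall>x \<in> bitstrings m. set_pmf (q x) \<subseteq> bitstrings n) \<and>
        (\<forall>i < m. \<forall>s \<in> bitstrings n. l i s \<in> {0..1}) \<and>
        (\<forall>x \<in> bitstrings m. \<forall>i < m. decode_prob n (l i) (q x) (x ! i) > p))"

end

theory Submission
  imports Defs
begin

text \<open>
  A Hermitian \<open>d \<times> d\<close> matrix is a real vector with \<open>d\<^sup>2\<close> coordinates, and the trace of a product is a
  weighted inner product of coordinates, so the quantum case with \<open>d = 2 ^ n\<close> is the classical case
  with \<open>4 ^ n\<close> in place of \<open>2 ^ n\<close>, up to positivity; the latter only matters for the existence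
  of codes, where it follows from diagonal dominance.

  Let \<open>D\<close> be the dimension, \<open>e i\<close> the decoding functionals and \<open>u\<close> the normalisation. If there are
  at least \<open>D\<close> functionals, then \<open>u\<close> and the \<open>e i - u/2\<close> are linearly dependent. Choose the
  coefficient of \<open>u\<close> to be nonnegative and read off the bits \<open>x\<close> from the signs of the other
  coefficients: on a code of \<open>x\<close> every nonzero term of the dependence is positive, which is absurd.

  With \<open>D - 1\<close> functionals, perturb the maximally mixed state slightly, with freely chosen signs in
  all coordinates but one, which restores the normalisation; each sign is decoded by
  an effect that singles out its coordinate, shifted to be unbiased on the maximally mixed state.
\<close>

section \<open>Linear dependence and sign patterns\<close>

text \<open>Gaussian elimination: a pivot vector with nonzero coordinate \<open>p\<close> clears
  that coordinate from the others, which leaves one vector and one coordinate fewer.\<close>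

lemma exists_linear_dependence:
  fixes v :: "'i \<Rightarrow> 'j \<Rightarrow> real"
  assumes "finite J" "finite I" "card J < card I"
  shows "\<exists>c. (\<exists>i\<in>I. c i \<noteq> 0) \<and> (\<forall>p\<in>J. (\<Sum>i\<in>I. c i * v i p) = 0)"
  using assms
proof (induction J arbitrary: I v rule: finite_induct)
  case empty
  then have "I \<noteq> {}" by auto
  then show ?case by (intro exI[of _ "\<lambda>_. 1"]) auto
next
  case (insert p J)
  show ?case
  proof (cases "\<forall>i\<in>I. v i p = 0")
    case True
    have "card J < card I" using insert by simp
    from insert.IH[OF insert.prems(1) this, of v] True show ?thesis by auto
  next
    case False
    then obtain k where k: "k \<in> I" "v k p \<noteq> 0" by auto
    define v' where "v' i q = v i q - v i p / v k p * v k q" for i q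
    have "card J < card (I - {k})" using insert k by simp
    then obtain c where c: "\<exists>i\<in>I - {k}. c i \<noteq> 0" "\<forall>q\<in>J. (\<Sum>i\<in>I - {k}. c i * v' i q) = 0"
      using insert.IH[of "I - {k}" v'] insert.prems by auto
    \<comment> \<open>The pivot's coefficient collects the multiples of \<open>v k\<close> that were
      subtracted in \<open>v'\<close>.\<close>
    define c' where "c' i = (if i = k then - (\<Sum>i\<in>I - {k}. c i * v i p) / v k p else c i)" for i
    have sum: "(\<Sum>i\<in>I. c' i * v i q) = (\<Sum>i\<in>I - {k}. c i * v' i q)" for q
    proof -
      have "(\<Sum>i\<in>I. c' i * v i q) = c' k * v k q + (\<Sum>i\<in>I - {k}. c' i * v i q)"
        using k insert.prems by (simp add: sum.remove)
      also have "(\<Sum>i\<in>I - {k}. c' i * v i q) = (\<Sum>i\<in>I - {k}. c i * v i q)"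
        by (intro sum.cong) (auto simp: c'_def)
      also have "c' k * v k q = - (\<Sum>i\<in>I - {k}. c i * (v i p / v k p * v k q))"
        by (simp add: c'_def sum_distrib_left sum_distrib_right sum_divide_distrib sum_negf mult_ac)
      finally show ?thesis
        by (simp add: v'_def right_diff_distrib sum_subtractf)
    qed
    have "(\<Sum>i\<in>I. c' i * v i p) = 0"
      unfolding sum using k by (simp add: v'_def)
    moreover have "\<exists>i\<in>I. c' i \<noteq> 0" using c(1) by (auto simp: c'_def)
    ultimately show ?thesis using c(2) sum by (intro exI[of _ c']) auto
  qed
qed

text \<open>Core of both impossibility proofs: \<open>x\<close> is fixed before the code vector
  \<open>r\<close>, and depends only on the functionals \<open>e\<close> and
  \<open>u\<close>.\<close>

lemma unrealizable_sign_pattern: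
  fixes e :: "nat \<Rightarrow> 'j \<Rightarrow> real" and u :: "'j \<Rightarrow> real"
  assumes J: "finite J" "card J \<le> m"
  obtains x where "length x = m"
    and "\<And>r. (\<Sum>p\<in>J. u p * r p) = 1 \<Longrightarrow>
           (\<And>i. i < m \<Longrightarrow> if x ! i then (\<Sum>p\<in>J. e i p * r p) < 1/2 else (\<Sum>p\<in>J. e i p * r p) > 1/2)
           \<Longrightarrow> False"
proof -
  \<comment> \<open>Index \<open>m\<close> stands for \<open>u\<close>, so there are
    \<open>m + 1\<close> vectors in at most \<open>m\<close> coordinates. On normalised
    \<open>r\<close>, subtracting \<open>u p / 2\<close> moves the threshold 1/2 to 0.\<close>
  define v where "v i p = (if i < m then e i p - u p / 2 else u p)" for i p
  obtain c0 where c0: "\<exists>i\<in>{..m}. c0 i \<noteq> 0" "\<forall>p\<in>J. (\<Sum>i\<le>m. c0 i * v i p) = 0"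
    using exists_linear_dependence[of J "{..m}" v] J by auto
  \<comment> \<open>\<open>u\<close> always pairs to 1, so its coefficient has to be made
    nonnegative by a global sign change; the other signs are absorbed by the bits.\<close>
  define c where "c i = (if c0 m < 0 then - c0 i else c0 i)" for i
  have c: "\<exists>i\<in>{..m}. c i \<noteq> 0" "c m \<ge> 0"
    using c0(1) by (auto simp: c_def)
  have c_sum: "(\<Sum>i\<le>m. c i * v i p) = 0" if "p \<in> J" for p
    using c0(2) that by (cases "c0 m < 0") (auto simp: c_def sum_negf)
  define x where "x = map (\<lambda>i. c i < 0) [0..<m]"
  show thesis
  proof
    show "length x = m" by (simp add: x_def)
    fix r
    assume u: "(\<Sum>p\<in>J. u p * r p) = 1"
      and e: "\<And>i. i < m \<Longrightarrow> if x ! i then (\<Sum>p\<in>J. e i p * r p) < 1/2 else (\<Sum>p\<in>J. e i p * r p) > 1/2"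
    define L where "L i = (\<Sum>p\<in>J. v i p * r p)" for i
    have L: "L i = (if i < m then (\<Sum>p\<in>J. e i p * r p) - 1/2 else 1)" for i
    proof (cases "i < m")
      case True
      then have "L i = (\<Sum>p\<in>J. e i p * r p) - (\<Sum>p\<in>J. u p * r p) / 2"
        by (simp add: L_def v_def left_diff_distrib sum_subtractf sum_divide_distrib)
      then show ?thesis using True u by simp
    qed (use u in \<open>simp add: L_def v_def\<close>)
    \<comment> \<open>Bit 1 means both \<open>c i < 0\<close> and \<open>L i < 0\<close>; bit 0
      means \<open>L i > 0\<close> with \<open>c i \<ge> 0\<close>.\<close>
    have pos: "c i * L i \<ge> 0 \<and> (c i \<noteq> 0 \<longrightarrow> c i * L i > 0)" if "i \<le> m" for i
    proof (cases "i = m")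
      case True
      then show ?thesis using c(2) by (simp add: L)
    next
      case False
      then have "i < m" using that by simp
      then have "c i * L i > 0" if "c i \<noteq> 0"
        using e[of i] that
        by (cases "c i" "0::real" rule: linorder_cases) (auto simp: L x_def intro: mult_neg_neg)
      then show ?thesis by (cases "c i = 0") auto
    qed
    have "(\<Sum>i\<le>m. c i * L i) = (\<Sum>p\<in>J. (\<Sum>i\<le>m. c i * v i p) * r p)"
      unfolding L_def sum_distrib_left sum_distrib_right by (subst sum.swap) (simp add: mult_ac)
    also have "\<dots> = 0" using c_sum by simp
    finally have "(\<Sum>i\<le>m. c i * L i) = 0" .
    then have "\<forall>i\<in>{..m}. c i * L i = 0"
      using pos by (subst (asm) sum_nonneg_eq_0_iff) auto
    with pos c(1) show False by fastforce
  qed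
qed

text \<open>The value at \<open>j0\<close> is sacrificed to make the sum zero; it is minus a sum of
  \<open>card J - 1\<close> values of modulus at most 1.\<close>

lemma balanced_extension:
  fixes \<sigma> :: "'j \<Rightarrow> real"
  assumes "finite J" "j0 \<in> J" "\<And>j. j \<in> J \<Longrightarrow> \<bar>\<sigma> j\<bar> \<le> 1"
  obtains \<tau> where "(\<Sum>j\<in>J. \<tau> j) = 0" "\<And>j. j \<noteq> j0 \<Longrightarrow> \<tau> j = \<sigma> j"
    and "\<And>j. j \<in> J \<Longrightarrow> \<bar>\<tau> j\<bar> \<le> card J"
proof -
  define \<tau> where "\<tau> j = (if j = j0 then - (\<Sum>j\<in>J - {j0}. \<sigma> j) else \<sigma> j)" for j
  have "(\<Sum>j\<in>J. \<tau> j) = \<tau> j0 + (\<Sum>j\<in>J - {j0}. \<tau> j)"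
    using assms by (simp add: sum.remove)
  also have "(\<Sum>j\<in>J - {j0}. \<tau> j) = (\<Sum>j\<in>J - {j0}. \<sigma> j)"
    by (intro sum.cong) (auto simp: \<tau>_def)
  finally have 1: "(\<Sum>j\<in>J. \<tau> j) = 0" by (simp add: \<tau>_def)
  have card: "card J \<ge> 1" using assms card_gt_0_iff[of J] by fastforce
  have "\<bar>\<Sum>j\<in>J - {j0}. \<sigma> j\<bar> \<le> (\<Sum>j\<in>J - {j0}. 1)"
    by (rule order.trans[OF sum_abs sum_mono]) (use assms in auto)
  also have "\<dots> \<le> card J" using assms by (simp add: card_mono)
  finally have "\<bar>\<tau> j\<bar> \<le> card J" if "j \<in> J" for j
    using assms(3)[OF that] card by (auto simp: \<tau>_def)
  with 1 that[of \<tau>] show thesis by (auto simp: \<tau>_def)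
qed

section \<open>Classical codes\<close>

lemma card_bitstrings: "card (bitstrings n) = 2 ^ n"
  and finite_bitstrings: "finite (bitstrings n)"
  using card_lists_length_eq[of "UNIV :: bool set" n] finite_lists_length_eq[of "UNIV :: bool set" n]
  by (simp_all add: bitstrings_def)

lemma exists_pmf_of_finite_weights:
  fixes r :: "'a \<Rightarrow> real"
  assumes "finite S" "\<And>s. s \<in> S \<Longrightarrow> r s \<ge> 0" "(\<Sum>s\<in>S. r s) = 1"
  obtains q where "set_pmf q \<subseteq> S" "\<And>s. s \<in> S \<Longrightarrow> pmf q s = r s"
proof -
  define f where "f s = (if s \<in> S then r s else 0)" for s
  have "(\<integral>\<^sup>+ s. ennreal (f s) \<partial>count_space UNIV) = (\<Sum>s\<in>S. ennreal (f s))"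
    using assms(1) by (intro nn_integral_count_space'[of S]) (auto simp: f_def)
  also have "\<dots> = ennreal (\<Sum>s\<in>S. f s)"
    using assms(2) by (intro sum_ennreal) (auto simp: f_def)
  also have "(\<Sum>s\<in>S. f s) = 1" using assms(3) by (simp add: f_def)
  finally have 1: "(\<integral>\<^sup>+ s. ennreal (f s) \<partial>count_space UNIV) = 1" by simp
  have 0: "f s \<ge> 0" for s using assms(2) by (simp add: f_def)
  have "pmf (embed_pmf f) s = f s" for s
    by (rule pmf_embed_pmf) (use 0 1 in auto)
  then show thesis
    by (intro that[of "embed_pmf f"]) (auto simp: f_def set_pmf_iff split: if_splits)
qed

lemma not_RAC_gt_half: "\<not> RAC_gt (2 ^ n) n (1 / 2)"
proof
  assume "RAC_gt (2 ^ n) n (1 / 2)"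
  then obtain q l where
    q: "\<And>x. x \<in> bitstrings (2 ^ n) \<Longrightarrow> set_pmf (q x) \<subseteq> bitstrings n" and
    p: "\<And>x i. x \<in> bitstrings (2 ^ n) \<Longrightarrow> i < 2 ^ n \<Longrightarrow> decode_prob n (l i) (q x) (x ! i) > 1 / 2"
    unfolding RAC_gt_def by blast
  obtain x :: "bool list" where x: "length x = 2 ^ n" and
    no: "\<And>r. (\<Sum>s\<in>bitstrings n. 1 * r s) = 1 \<Longrightarrow>
           (\<And>i. i < 2 ^ n \<Longrightarrow> if x ! i then (\<Sum>s\<in>bitstrings n. l i s * r s) < 1/2
              else (\<Sum>s\<in>bitstrings n. l i s * r s) > 1/2) \<Longrightarrow> False"
    using unrealizable_sign_pattern[OF finite_bitstrings eq_refl[OF card_bitstrings],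
        where u = "\<lambda>_. 1" and e = l] by metis
  have xb: "x \<in> bitstrings (2 ^ n)" using x by (simp add: bitstrings_def)
  have 1: "(\<Sum>s\<in>bitstrings n. pmf (q x) s) = 1"
    using sum_pmf_eq_1[OF finite_bitstrings q[OF xb]] .
  show False
  proof (rule no[of "pmf (q x)"])
    fix i :: nat assume "i < 2 ^ n"
    from p[OF xb this]
    show "if x ! i then (\<Sum>s\<in>bitstrings n. l i s * pmf (q x) s) < 1/2
          else (\<Sum>s\<in>bitstrings n. l i s * pmf (q x) s) > 1/2"
      using 1 by (auto simp: decode_prob_def right_diff_distrib sum_subtractf mult.commute)
  qed (use 1 in simp)
qed

text \<open>Each bit is matched with one codeword other than \<open>s0\<close> and stored as the
  sign of that codeword's deviation from the uniform probability.\<close>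

lemma RAC_gt_half: "RAC_gt (2 ^ n - 1) n (1 / 2)"
proof -
  define d :: real where "d = 2 ^ n"
  have d: "d \<ge> 1" by (simp add: d_def)
  define s0 where "s0 = replicate n False"
  have s0: "s0 \<in> bitstrings n" by (simp add: s0_def bitstrings_def)
  have "card (bitstrings n - {s0}) = 2 ^ n - 1"
    using s0 by (simp add: card_bitstrings finite_bitstrings)
  then obtain h where h: "bij_betw h {..<2 ^ n - 1 :: nat} (bitstrings n - {s0})"
    using ex_bij_betw_nat_finite[of "bitstrings n - {s0}"] finite_bitstrings
    by (auto simp: atLeast0LessThan)
  define g where "g = inv_into {..<2 ^ n - 1 :: nat} h"
  have g: "g (h i) = i" "h i \<in> bitstrings n" "h i \<noteq> s0" if "i < 2 ^ n - 1" for i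
    using that h bij_betw_inv_into_left[OF h, of i] by (auto simp: g_def bij_betw_def)
  \<comment> \<open>Codeword \<open>h i\<close> gets an extra 1/2; the offset 1/(2d) cancels its
    mean, so that the uniform distribution yields output 0 with probability exactly 1/2.\<close>
  define l where "l i s = (1/2 - 1 / (2 * d)) + (if s = h i then 1/2 else 0)" for i s
  have "\<exists>q. set_pmf q \<subseteq> bitstrings n \<and> (\<forall>i<2 ^ n - 1. decode_prob n (l i) q (x ! i) > 1/2)" for x
  proof -
    \<comment> \<open>At \<open>s0\<close> the value of \<open>g\<close> is unspecified, but
      \<open>\<tau>\<close> overrides \<sigma> there.\<close>
    define \<sigma> :: "bool list \<Rightarrow> real" where "\<sigma> s = (if x ! g s then -1 else 1)" for s
    obtain \<tau> where \<tau>: "(\<Sum>s\<in>bitstrings n. \<tau> s) = 0" "\<And>s. s \<noteq> s0 \<Longrightarrow> \<tau> s = \<sigma> s"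
      "\<And>s. s \<in> bitstrings n \<Longrightarrow> \<bar>\<tau> s\<bar> \<le> d"
      by (rule balanced_extension[OF finite_bitstrings s0, of \<sigma>])
        (simp_all add: card_bitstrings d_def \<sigma>_def)
    \<comment> \<open>As \<tau> is bounded by \<open>d\<close>, dividing by \<open>d^2\<close> keeps
      the perturbation within 1/d.\<close>
    define r where "r s = 1 / d + \<tau> s / d\<^sup>2" for s
    have r0: "r s \<ge> 0" if "s \<in> bitstrings n" for s
      using \<tau>(3)[OF that] d by (auto simp: r_def field_simps power2_eq_square)
    have r1: "(\<Sum>s\<in>bitstrings n. r s) = 1"
      using \<tau>(1) d by (simp add: r_def sum.distrib sum_divide_distrib[symmetric] card_bitstrings d_def)
    obtain q where q: "set_pmf q \<subseteq> bitstrings n" "\<And>s. s \<in> bitstrings n \<Longrightarrow> pmf q s = r s"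
      using exists_pmf_of_finite_weights[OF finite_bitstrings r0 r1] by metis
    have "decode_prob n (l i) q (x ! i) > 1/2" if i: "i < 2 ^ n - 1" for i
    proof -
      have "(\<Sum>s\<in>bitstrings n. r s * l i s)
          = (\<Sum>s\<in>bitstrings n. r s) * (1/2 - 1 / (2 * d)) + (\<Sum>s\<in>bitstrings n. if s = h i then r s / 2 else 0)"
        unfolding sum_distrib_right sum.distrib[symmetric]
        by (intro sum.cong) (auto simp: l_def algebra_simps)
      also have "\<dots> = 1/2 - 1 / (2 * d) + r (h i) / 2"
        using g[OF i] by (simp add: r1 finite_bitstrings)
      also have "\<dots> = 1/2 + \<sigma> (h i) / (2 * d\<^sup>2)"
        using \<tau>(2)[OF g(3)[OF i]] by (simp add: r_def field_simps)
      finally have *: "(\<Sum>s\<in>bitstrings n. r s * l i s) = 1/2 + \<sigma> (h i) / (2 * d\<^sup>2)" .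
      show ?thesis
      proof (cases "x ! i")
        case True
        then have "decode_prob n (l i) q (x ! i) = 1 - (\<Sum>s\<in>bitstrings n. r s * l i s)"
          using r1 by (simp add: decode_prob_def q(2) right_diff_distrib sum_subtractf)
        then show ?thesis using True d unfolding * by (simp add: \<sigma>_def g(1)[OF i])
      next
        case False
        then have "decode_prob n (l i) q (x ! i) = (\<Sum>s\<in>bitstrings n. r s * l i s)"
          by (simp add: decode_prob_def q(2))
        then show ?thesis using False d unfolding * by (simp add: \<sigma>_def g(1)[OF i])
      qed
    qed
    with q(1) show ?thesis by blast
  qed
  then obtain q where "\<And>x. set_pmf (q x) \<subseteq> bitstrings n"
    "\<And>x i. i < 2 ^ n - 1 \<Longrightarrow> decode_prob n (l i) (q x) (x ! i) > 1/2" by metis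
  moreover have "l i s \<in> {0..1}" for i s
    using d by (auto simp: l_def field_simps)
  ultimately show ?thesis unfolding RAC_gt_def by blast
qed

section \<open>Coordinates of Hermitian matrices\<close>

text \<open>Coordinates on and above the diagonal hold real parts; the coordinate at \<open>(k, j)\<close> with \<open>j < k\<close>
  holds the imaginary part of the entry at \<open>(j, k)\<close>.\<close>

definition herm :: "nat \<Rightarrow> (nat \<times> nat \<Rightarrow> real) \<Rightarrow> complex mat" where
  "herm d g = Matrix.mat d d (\<lambda>(j, k). Complex (g (min j k, max j k))
     (if j < k then g (k, j) else if k < j then - g (j, k) else 0))"

definition herm_coords :: "complex mat \<Rightarrow> nat \<times> nat \<Rightarrow> real" where
  "herm_coords A = (\<lambda>(j, k). if j \<le> k then Re (A $$ (j, k)) else Im (A $$ (k, j)))"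

text \<open>Coordinates of the identity matrix; divided by \<open>d\<close>, those of the maximally
  mixed state.\<close>

definition diag_ind :: "nat \<times> nat \<Rightarrow> real" where
  "diag_ind = (\<lambda>(j, k). if j = k then 1 else 0)"

text \<open>An off-diagonal coordinate occurs in two conjugate entries, so it counts twice in the
  trace of a product.\<close>

definition herm_weight :: "nat \<times> nat \<Rightarrow> real" where
  "herm_weight = (\<lambda>(j, k). if j = k then 1 else 2)"

lemma herm_carrier [simp]: "herm d g \<in> carrier_mat d d"
  and dim_herm [simp]: "dim_row (herm d g) = d" "dim_col (herm d g) = d"
  by (auto simp: herm_def)

lemma herm_index: "j < d \<Longrightarrow> k < d \<Longrightarrow> herm d g $$ (j, k) = Complex (g (min j k, max j k))
     (if j < k then g (k, j) else if k < j then - g (j, k) else 0)"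
  by (simp add: herm_def)

lemma mat_adjoint_index:
  fixes A :: "complex mat"
  assumes "A \<in> carrier_mat d d" "j < d" "k < d"
  shows "mat_adjoint A $$ (j, k) = cnj (A $$ (k, j))"
  using assms by (auto simp: mat_adjoint_def mat_of_rows_def)

lemma herm_index_cnj:
  "j < d \<Longrightarrow> k < d \<Longrightarrow> herm d g $$ (k, j) = cnj (herm d g $$ (j, k))"
  by (auto simp: herm_index complex_eq_iff min_def max_def)

text \<open>The coordinates drop only the entries below the diagonal and the imaginary parts on it,
  both of which Hermiticity determines.\<close>

lemma herm_herm_coords:
  assumes "A \<in> carrier_mat d d" "mat_adjoint A = A"
  shows "herm d (herm_coords A) = A"
proof (rule eq_matI)
  fix j k assume "j < dim_row A" "k < dim_col A"
  then have "j < d" "k < d" using assms by auto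
  then have "A $$ (j, k) = cnj (A $$ (k, j))" "A $$ (j, j) = cnj (A $$ (j, j))"
    using mat_adjoint_index[OF assms(1)] assms(2) by metis+
  then show "herm d (herm_coords A) $$ (j, k) = A $$ (j, k)"
    using \<open>j < d\<close> \<open>k < d\<close>
    by (auto simp: herm_index herm_coords_def complex_eq_iff min_def max_def)
qed (use assms in auto)

lemma one_minus_herm: "1\<^sub>m d - herm d g = herm d (\<lambda>p. diag_ind p - g p)"
  by (rule eq_matI) (auto simp: herm_index diag_ind_def complex_eq_iff min_def max_def)

lemma mat_trace_herm: "mat_trace (herm d g) = of_real (\<Sum>j<d. g (j, j))"
  by (auto simp: mat_trace_def herm_index complex_eq_iff intro!: sum.cong)

lemma Re_mat_trace_herm_mult:
  "Re (mat_trace (herm d g * herm d h)) = (\<Sum>p\<in>{..<d}\<times>{..<d}. g p * (herm_weight p * h p))"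
proof -
  \<comment> \<open>Entry \<open>(j, k)\<close> contributes a real-part and an imaginary-part
    product, stored at \<open>(j, k)\<close> and \<open>(k, j)\<close>. The factor 1/2 offsets
    double counting for \<open>j = k\<close>.\<close>
  define f where "f j k = (if j = k then 1/2 else 1) * g (j, k) * h (j, k)" for j k
  have "Re (mat_trace (herm d g * herm d h))
      = (\<Sum>j<d. \<Sum>k<d. Re (herm d g $$ (j, k) * herm d h $$ (k, j)))"
    by (simp add: mat_trace_def scalar_prod_def atLeast0LessThan)
  also have "\<dots> = (\<Sum>j<d. \<Sum>k<d. f j k + f k j)"
    by (intro sum.cong refl)
       (auto simp: herm_index f_def min_def max_def)
  also have "\<dots> = (\<Sum>j<d. \<Sum>k<d. f j k) + (\<Sum>j<d. \<Sum>k<d. f k j)"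
    by (simp add: sum.distrib)
  also have "(\<Sum>j<d. \<Sum>k<d. f k j) = (\<Sum>j<d. \<Sum>k<d. f j k)"
    by (rule sum.swap)
  also have "(\<Sum>j<d. \<Sum>k<d. f j k) + (\<Sum>j<d. \<Sum>k<d. f j k) = (\<Sum>j<d. \<Sum>k<d. 2 * f j k)"
    by (simp add: sum_distrib_left[symmetric])
  also have "\<dots> = (\<Sum>p\<in>{..<d}\<times>{..<d}. g p * (herm_weight p * h p))"
    unfolding sum.cartesian_product
    by (intro sum.cong) (auto simp: f_def herm_weight_def)
  finally show ?thesis .
qed

lemma sum_diag_ind:
  "(\<Sum>p\<in>{..<d}\<times>{..<d}. diag_ind p * (herm_weight p * g p)) = (\<Sum>j<d. g (j, j))"
proof -
  have "(\<Sum>p\<in>{..<d}\<times>{..<d}. diag_ind p * (herm_weight p * g p))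
      = (\<Sum>j<d. \<Sum>k<d. if j = k then g (j, k) else 0)"
    unfolding sum.cartesian_product
    by (intro sum.cong) (auto simp: diag_ind_def herm_weight_def)
  then show ?thesis by simp
qed

lemma povm_prob_herm:
  assumes "mat_trace (herm (2 ^ n) r) = 1"
  shows "povm_prob n (herm (2 ^ n) g) (herm (2 ^ n) r) b =
    (let t = \<Sum>p\<in>{..<2 ^ n}\<times>{..<2 ^ n}. g p * (herm_weight p * r p) in if b then 1 - t else t)"
proof -
  have "(\<Sum>j<2 ^ n. r (j, j)) = 1"
    using assms unfolding mat_trace_herm by (metis of_real_eq_1_iff)
  then show ?thesis
    by (simp add: povm_prob_def Let_def one_minus_herm Re_mat_trace_herm_mult
        left_diff_distrib sum_subtractf sum_diag_ind)
qed

text \<open>The cross terms of the quadratic form are bounded by 2 \<open>y j * y k\<close> \<le>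
  \<open>(y j)\<^sup>2 + (y k)\<^sup>2\<close>; after using dominance, what remains is antisymmetric
  in \<open>j\<close> and \<open>k\<close> and sums to zero.\<close>

lemma diag_dominant_imp_pos_semidef:
  assumes dom: "\<And>j. j < d \<Longrightarrow> (\<Sum>k\<in>{..<d} - {j}. cmod (herm d g $$ (j, k))) \<le> g (j, j)"
  shows "pos_semidef d (herm d g)"
  unfolding pos_semidef_def
proof (intro conjI ballI)
  have "mat_adjoint (herm d g) \<in> carrier_mat d d"
    by (auto simp: mat_adjoint_def)
  then show "mat_adjoint (herm d g) = herm d g"
    by (intro eq_matI) (auto simp: mat_adjoint_index[OF herm_carrier] herm_index_cnj[symmetric])
  fix v :: "complex Matrix.vec" assume v: "v \<in> carrier_vec d"
  define a where "a j k = cmod (herm d g $$ (j, k))" for j k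
  define y where "y j = cmod (vec_index v j)" for j
  define t where "t j k = Re (herm d g $$ (j, k) * vec_index v k * cnj (vec_index v j))" for j k
  have "Re ((herm d g *\<^sub>v v) \<bullet>c v) = (\<Sum>j<d. \<Sum>k<d. t j k)"
    using v by (simp add: scalar_prod_def t_def atLeast0LessThan sum_distrib_right)
  also have "\<dots> = (\<Sum>j<d. g (j, j) * (y j)\<^sup>2 + (\<Sum>k\<in>{..<d} - {j}. t j k))"
  proof (intro sum.cong refl)
    fix j assume "j \<in> {..<d}"
    then have "t j j = g (j, j) * (y j)\<^sup>2"
      by (simp add: t_def y_def herm_index cmod_power2) (simp add: power2_eq_square algebra_simps)
    then show "(\<Sum>k<d. t j k) = g (j, j) * (y j)\<^sup>2 + (\<Sum>k\<in>{..<d} - {j}. t j k)"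
      using sum.remove[of "{..<d}" j "t j"] \<open>j \<in> {..<d}\<close> by simp
  qed
  also have "\<dots> \<ge> (\<Sum>j<d. (\<Sum>k\<in>{..<d} - {j}. a j k) * (y j)\<^sup>2
                   + (\<Sum>k\<in>{..<d} - {j}. - (a j k * ((y j)\<^sup>2 + (y k)\<^sup>2) / 2)))"
  proof (intro sum_mono add_mono mult_right_mono)
    fix j k
    have "- t j k \<le> cmod (herm d g $$ (j, k) * vec_index v k * cnj (vec_index v j))"
      unfolding t_def using complex_Re_le_cmod[of "- (herm d g $$ (j, k) * vec_index v k * cnj (vec_index v j))"]
      by simp
    also have "\<dots> = a j k * (y j * y k)" by (simp add: a_def y_def norm_mult)
    also have "\<dots> \<le> a j k * (((y j)\<^sup>2 + (y k)\<^sup>2) / 2)"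
      by (intro mult_left_mono) (use sum_squares_bound[of "y j" "y k"] in \<open>auto simp: a_def\<close>)
    finally show "- (a j k * ((y j)\<^sup>2 + (y k)\<^sup>2) / 2) \<le> t j k" by simp
  qed (use dom in \<open>auto simp: a_def\<close>)
  also have "(\<Sum>j<d. (\<Sum>k\<in>{..<d} - {j}. a j k) * (y j)\<^sup>2
                   + (\<Sum>k\<in>{..<d} - {j}. - (a j k * ((y j)\<^sup>2 + (y k)\<^sup>2) / 2)))
      = (\<Sum>j<d. \<Sum>k\<in>{..<d} - {j}. a j k * ((y j)\<^sup>2 - (y k)\<^sup>2) / 2)"
    unfolding sum_distrib_right sum.distrib[symmetric]
    by (intro sum.cong refl) (simp add: field_simps)
  \<comment> \<open>The terms with \<open>k = j\<close> vanish; adding them makes the index set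
    symmetric.\<close>
  also have "\<dots> = (\<Sum>j<d. \<Sum>k<d. a j k * ((y j)\<^sup>2 - (y k)\<^sup>2) / 2)"
    by (rule sum.cong[OF refl], rule sum.mono_neutral_left) auto
  also have "\<dots> = 0"
  proof -
    let ?S = "\<Sum>j<d. \<Sum>k<d. a j k * ((y j)\<^sup>2 - (y k)\<^sup>2) / 2"
    have "?S = (\<Sum>k<d. \<Sum>j<d. a j k * ((y j)\<^sup>2 - (y k)\<^sup>2) / 2)" by (rule sum.swap)
    also have "\<dots> = (\<Sum>k<d. \<Sum>j<d. - (a k j * ((y k)\<^sup>2 - (y j)\<^sup>2) / 2))"
    proof (intro sum.cong refl)
      fix k j assume "k \<in> {..<d}" "j \<in> {..<d}"
      then have "a j k = a k j" using herm_index_cnj[of j d k g] by (simp add: a_def)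
      then show "a j k * ((y j)\<^sup>2 - (y k)\<^sup>2) / 2 = - (a k j * ((y k)\<^sup>2 - (y j)\<^sup>2) / 2)"
        by (simp add: field_simps)
    qed
    also have "\<dots> = - ?S" by (simp add: sum_negf)
    finally show ?thesis by simp
  qed
  finally show "Re ((herm d g *\<^sub>v v) \<bullet>c v) \<ge> 0" .
qed simp

section \<open>Quantum codes\<close>

text \<open>There are \<open>2 ^ n * 2 ^ n\<close> Hermitian coordinates, as many as effects. The
  trace serves as the normalisation.\<close>

lemma not_QRAC_gt_half: "\<not> QRAC_gt (2 ^ (2 * n)) n (1 / 2)"
proof
  let ?m = "2 ^ (2 * n) :: nat" and ?d = "2 ^ n :: nat"
  let ?J = "{..<?d} \<times> {..<?d}"
  assume "QRAC_gt ?m n (1 / 2)"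
  then obtain \<rho> E where
    \<rho>: "\<And>x. x \<in> bitstrings ?m \<Longrightarrow> qubit_state n (\<rho> x)" and
    E: "\<And>i. i < ?m \<Longrightarrow> qubit_povm n (E i)" and
    p: "\<And>x i. x \<in> bitstrings ?m \<Longrightarrow> i < ?m \<Longrightarrow> povm_prob n (E i) (\<rho> x) (x ! i) > 1 / 2"
    unfolding QRAC_gt_def by blast
  have "card ?J \<le> ?m" by (simp add: mult_2 power_add)
  then obtain x :: "bool list" where x: "length x = ?m" and
    no: "\<And>r. (\<Sum>p\<in>?J. diag_ind p * r p) = 1 \<Longrightarrow>
           (\<And>i. i < ?m \<Longrightarrow> if x ! i then (\<Sum>p\<in>?J. herm_coords (E i) p * r p) < 1/2
              else (\<Sum>p\<in>?J. herm_coords (E i) p * r p) > 1/2) \<Longrightarrow> False"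
    using unrealizable_sign_pattern[of ?J ?m diag_ind "\<lambda>i. herm_coords (E i)"] by auto
  have xb: "x \<in> bitstrings ?m" using x by (simp add: bitstrings_def)
  define r where "r = herm_coords (\<rho> x)"
  have r: "\<rho> x = herm ?d r" and tr: "mat_trace (herm ?d r) = 1"
    using \<rho>[OF xb] by (auto simp: qubit_state_def pos_semidef_def r_def herm_herm_coords)
  have "(\<Sum>j<?d. r (j, j)) = 1"
    using tr unfolding mat_trace_herm by (metis of_real_eq_1_iff)
  show False
  \<comment> \<open>Putting the weights into the state vector turns the trace pairing into a plain
    inner product.\<close>
  proof (rule no[of "\<lambda>p. herm_weight p * r p"])
    show "(\<Sum>p\<in>?J. diag_ind p * (herm_weight p * r p)) = 1"
      unfolding sum_diag_ind by fact
    fix i assume i: "i < ?m"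
    have "E i = herm ?d (herm_coords (E i))"
      using E[OF i] by (auto simp: qubit_povm_def pos_semidef_def herm_herm_coords)
    with p[OF xb i] r have "povm_prob n (herm ?d (herm_coords (E i))) (herm ?d r) (x ! i) > 1/2"
      by simp
    then show "if x ! i then (\<Sum>p\<in>?J. herm_coords (E i) p * (herm_weight p * r p)) < 1/2
               else (\<Sum>p\<in>?J. herm_coords (E i) p * (herm_weight p * r p)) > 1/2"
      unfolding povm_prob_herm[OF tr] by (auto simp: Let_def)
  qed
qed

text \<open>Half the basis matrix of coordinate \<open>q\<close> plus the multiple of the identity
  that gives outcome 0 probability 1/2 on the maximally mixed state.\<close>

definition effect_coords :: "nat \<Rightarrow> nat \<times> nat \<Rightarrow> nat \<times> nat \<Rightarrow> real" where
  "effect_coords d q p = (1/2 - diag_ind q / (2 * d)) * diag_ind p + (if p = q then 1/2 else 0)"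

lemma qubit_povm_effect:
  "qubit_povm n (herm (2 ^ n) (effect_coords (2 ^ n) q))"
proof -
  define d :: nat where "d = 2 ^ n"
  have d: "d \<ge> 1" by (simp add: d_def)
  obtain a b where q: "q = (a, b)" by force
  \<comment> \<open>A general \<open>g\<close> covers both the effect and its complement, whose
    off-diagonal coordinates differ only in sign.\<close>
  have off: "(\<Sum>k\<in>{..<d} - {j}. cmod (herm d g $$ (j, k))) \<le> (if a \<noteq> b then 1/2 else 0)"
    if j: "j < d" and g: "\<And>p. diag_ind p = 0 \<Longrightarrow> \<bar>g p\<bar> = (if p = q then 1/2 else 0)" for j g
  proof -
    \<comment> \<open>The only column that can hold a nonzero off-diagonal entry of row
      \<open>j\<close>.\<close>
    define k0 where "k0 = (if j = a then b else a)"
    have "cmod (herm d g $$ (j, k)) \<le> (if k = k0 \<and> a \<noteq> b then 1/2 else 0)" if "k \<in> {..<d} - {j}" for k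
    proof -
      have "cmod (herm d g $$ (j, k)) \<le> \<bar>g (j, k)\<bar> + \<bar>g (k, j)\<bar>"
        using that j
        by (auto simp: herm_index min_def max_def intro: order.trans[OF cmod_le])
      also have "\<dots> \<le> (if k = k0 \<and> a \<noteq> b then 1/2 else 0)"
        using that g[of "(j, k)"] g[of "(k, j)"] by (auto simp: diag_ind_def q k0_def)
      finally show ?thesis .
    qed
    then have "(\<Sum>k\<in>{..<d} - {j}. cmod (herm d g $$ (j, k)))
        \<le> (\<Sum>k\<in>{..<d} - {j}. if k = k0 \<and> a \<noteq> b then 1/2 else 0)" by (rule sum_mono)
    also have "\<dots> \<le> (if a \<noteq> b then 1/2 else 0)" by (auto simp: sum.delta)
    finally show ?thesis .
  qed
  have "pos_semidef d (herm d (effect_coords d q))"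
  proof (rule diag_dominant_imp_pos_semidef, rule order.trans[OF off])
    fix j
    show "(if a \<noteq> b then 1/2 else 0) \<le> effect_coords d q (j, j)"
      using d by (auto simp: effect_coords_def diag_ind_def q field_simps)
  qed (auto simp: effect_coords_def)
  moreover have "pos_semidef d (herm d (\<lambda>p. diag_ind p - effect_coords d q p))"
  proof (rule diag_dominant_imp_pos_semidef, rule order.trans[OF off])
    fix j
    show "(if a \<noteq> b then 1/2 else 0) \<le> diag_ind (j, j) - effect_coords d q (j, j)"
      using d by (auto simp: effect_coords_def diag_ind_def q field_simps)
  qed (auto simp: effect_coords_def)
  ultimately show ?thesis by (simp add: qubit_povm_def one_minus_herm d_def)
qed

lemma effect_coords_pairing:
  assumes "q \<in> {..<d} \<times> {..<d}" "(\<Sum>j<d. r (j, j)) = 1"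
  shows "(\<Sum>p\<in>{..<d}\<times>{..<d}. effect_coords d q p * (herm_weight p * r p))
    = 1/2 + herm_weight q * (r q - diag_ind q / d) / 2"
proof -
  have "(\<Sum>p\<in>{..<d}\<times>{..<d}. effect_coords d q p * (herm_weight p * r p))
    = (1/2 - diag_ind q / (2 * d)) * (\<Sum>p\<in>{..<d}\<times>{..<d}. diag_ind p * (herm_weight p * r p))
      + (\<Sum>p\<in>{..<d}\<times>{..<d}. if p = q then herm_weight p * r p / 2 else 0)"
    unfolding sum_distrib_left sum.distrib[symmetric]
    by (intro sum.cong) (auto simp: effect_coords_def algebra_simps)
  also have "\<dots> = 1/2 - diag_ind q / (2 * d) + herm_weight q * r q / 2"
    using assms by (simp add: sum_diag_ind)
  \<comment> \<open>Where \<open>diag_ind q\<close> is nonzero the weight is 1, so it may be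
    factored out.\<close>
  also have "\<dots> = 1/2 + herm_weight q * (r q - diag_ind q / d) / 2"
    by (auto simp: herm_weight_def diag_ind_def field_simps split: prod.splits)
  finally show ?thesis .
qed

text \<open>Off-diagonal perturbations leave the trace unchanged, so only the diagonal needs
  balancing, at the cost of the coordinate \<open>(0, 0)\<close>.\<close>

lemma exists_signed_state:
  fixes \<sigma> :: "nat \<times> nat \<Rightarrow> real"
  assumes \<sigma>: "\<And>p. \<bar>\<sigma> p\<bar> \<le> 1"
  obtains r \<epsilon> where "\<epsilon> > 0" "qubit_state n (herm (2 ^ n) r)"
    and "\<And>p. p \<noteq> (0, 0) \<Longrightarrow> r p = diag_ind p / 2 ^ n + \<epsilon> * \<sigma> p"
proof -
  define d :: nat where "d = 2 ^ n"
  have d: "d \<ge> 1" by (simp add: d_def)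
  \<comment> \<open>Off-diagonal row sums are at most \<open>2 * \<epsilon> * d\<close> and diagonal
    deviations at most \<open>\<epsilon> * d\<close>; together they must not exceed 1/d.\<close>
  define \<epsilon> :: real where "\<epsilon> = 1 / (3 * (real d)\<^sup>2)"
  have \<epsilon>: "\<epsilon> > 0" using d by (simp add: \<epsilon>_def)
  obtain \<tau> where \<tau>: "(\<Sum>j<d. \<tau> j) = 0" "\<And>j. j \<noteq> 0 \<Longrightarrow> \<tau> j = \<sigma> (j, j)"
    "\<And>j. j < d \<Longrightarrow> \<bar>\<tau> j\<bar> \<le> d"
    using balanced_extension[of "{..<d}" 0 "\<lambda>j. \<sigma> (j, j)"] \<sigma> d by auto
  define r where "r = (\<lambda>(j, k). if j = k then 1 / d + \<epsilon> * \<tau> j else \<epsilon> * \<sigma> (j, k))"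
  have "pos_semidef d (herm d r)"
  proof (rule diag_dominant_imp_pos_semidef)
    fix j assume j: "j < d"
    have "cmod (herm d r $$ (j, k)) \<le> 2 * \<epsilon>" if "k \<in> {..<d} - {j}" for k
    proof -
      have "\<bar>r (j, k)\<bar> \<le> \<epsilon>" "\<bar>r (k, j)\<bar> \<le> \<epsilon>"
        using that \<sigma> \<epsilon> by (auto simp: r_def abs_mult mult_left_le)
      moreover have "cmod (herm d r $$ (j, k)) \<le> \<bar>r (j, k)\<bar> + \<bar>r (k, j)\<bar>"
        using that j
        by (auto simp: herm_index min_def max_def intro: order.trans[OF cmod_le])
      ultimately show ?thesis by linarith
    qed
    then have "(\<Sum>k\<in>{..<d} - {j}. cmod (herm d r $$ (j, k))) \<le> (\<Sum>k\<in>{..<d} - {j}. 2 * \<epsilon>)"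
      by (rule sum_mono)
    also have "\<dots> \<le> d * (2 * \<epsilon>)"
      using \<epsilon> j by (simp add: mult_right_mono)
    also have "\<dots> = 1 / d - \<epsilon> * d"
      using d by (simp add: \<epsilon>_def field_simps power2_eq_square)
    also have "\<dots> \<le> 1 / d + \<epsilon> * \<tau> j"
      using mult_left_mono[of "- real d" "\<tau> j" \<epsilon>] \<tau>(3)[OF j] \<epsilon> by auto
    finally show "(\<Sum>k\<in>{..<d} - {j}. cmod (herm d r $$ (j, k))) \<le> r (j, j)"
      by (simp add: r_def)
  qed
  moreover have "(\<Sum>j<d. r (j, j)) = 1"
    using \<tau>(1) d by (simp add: r_def sum.distrib sum_distrib_left[symmetric])
  ultimately have "qubit_state n (herm (2 ^ n) r)"
    by (simp add: qubit_state_def mat_trace_herm d_def)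
  moreover have "r p = diag_ind p / 2 ^ n + \<epsilon> * \<sigma> p" if "p \<noteq> (0, 0)" for p
    using that \<tau>(2) by (cases p) (auto simp: r_def diag_ind_def d_def)
  ultimately show thesis using that \<epsilon> by blast
qed

text \<open>Bit \<open>i\<close> is the sign of the perturbation at coordinate \<open>h i\<close>,
  and its effect decodes it with advantage
  \<open>\<epsilon> * herm_weight (h i) / 2\<close>.\<close>

lemma QRAC_gt_half: "QRAC_gt (2 ^ (2 * n) - 1) n (1 / 2)"
proof -
  let ?d = "2 ^ n :: nat"
  let ?J = "{..<?d} \<times> {..<?d}"
  let ?m = "2 ^ (2 * n) - 1 :: nat"
  have "card (?J - {(0, 0)}) = ?m"
    by (simp add: mult_2 power_add)
  then obtain h where h: "bij_betw h {..<?m} (?J - {(0, 0)})"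
    using ex_bij_betw_nat_finite[of "?J - {(0, 0)}"] by (auto simp: atLeast0LessThan)
  define g where "g = inv_into {..<?m} h"
  have g: "g (h i) = i" and hJ: "h i \<in> ?J" and h0: "h i \<noteq> (0, 0)" if "i < ?m" for i
    using that h bij_betw_inv_into_left[OF h, of i] by (auto simp: g_def bij_betw_def)
  have "\<exists>\<rho>. qubit_state n \<rho> \<and>
          (\<forall>i<?m. povm_prob n (herm ?d (effect_coords ?d (h i))) \<rho> (x ! i) > 1/2)" for x
  proof -
    define \<sigma> :: "nat \<times> nat \<Rightarrow> real" where "\<sigma> p = (if x ! g p then -1 else 1)" for p
    obtain r \<epsilon> where \<epsilon>: "\<epsilon> > 0" and state: "qubit_state n (herm ?d r)"
      and r: "\<And>p. p \<noteq> (0, 0) \<Longrightarrow> r p = diag_ind p / 2 ^ n + \<epsilon> * \<sigma> p"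
      by (rule exists_signed_state[of \<sigma> n]) (simp_all add: \<sigma>_def)
    have tr: "mat_trace (herm ?d r) = 1" using state by (simp add: qubit_state_def)
    then have r1: "(\<Sum>j<?d. r (j, j)) = 1"
      unfolding mat_trace_herm by (metis of_real_eq_1_iff)
    have "povm_prob n (herm ?d (effect_coords ?d (h i))) (herm ?d r) (x ! i) > 1/2"
      if i: "i < ?m" for i
    proof -
      have w: "herm_weight (h i) > 0" by (simp add: herm_weight_def split: prod.split)
      show ?thesis
        unfolding povm_prob_herm[OF tr] effect_coords_pairing[OF hJ[OF i] r1] r[OF h0[OF i]]
        using w \<epsilon> by (simp add: Let_def \<sigma>_def g[OF i])
    qed
    with state show ?thesis by blast
  qed
  then obtain \<rho> where "\<And>x. qubit_state n (\<rho> x)"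
    "\<And>x i. i < ?m \<Longrightarrow> povm_prob n (herm ?d (effect_coords ?d (h i))) (\<rho> x) (x ! i) > 1/2"
    by metis
  with qubit_povm_effect show ?thesis
    unfolding QRAC_gt_def
    by (intro exI[of _ \<rho>] exI[of _ "\<lambda>i. herm ?d (effect_coords ?d (h i))"]) auto
qed

theorem corollary5p3:
  fixes n :: nat
  assumes "n \<ge> 1"
  shows "QRAC_gt (2 ^ (2 * n) - 1) n (1 / 2) \<and>
         \<not> QRAC_gt (2 ^ (2 * n)) n (1 / 2) \<and>
         RAC_gt (2 ^ n - 1) n (1 / 2) \<and>
         \<not> RAC_gt (2 ^ n) n (1 / 2)"
  using QRAC_gt_half not_QRAC_gt_half RAC_gt_half not_RAC_gt_half by blast

end
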